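(* Let $n,t$ be integers with $0\le t\le n-4$, and let $\mathcal{E}(n,t)$ be the set of trees of order $n$ with exactly $t$ vertices of degree two. If $T\in\mathcal{E}(n,t)$ has maximum Mostar index among all trees in $\mathcal{E}(n,t)$, then $T\cong S_{n,n-t-1}$.
   Context: For a connected simple graph $G$, the Mostar index is $Mo(G)=\sum_{uv\in E(G)}|n_u-n_v|$, where for an edge $e=uv$, $n_u$ is the number of vertices of $G$ closer (in graph distance) to $u$ than to $v$, and $n_v$ is the number of vertices closer to $v$ than to $u$. The order of a graph is its number of vertices. For $3\le r\le n-2$, $S_{n,r}$ is the $n$-vertex tree consisting of $r$ pendent paths attached at a common vertex (i.e. a spider with $r$ legs), of which $s$ have length $\lfloor\frac{n-1}{r}\rfloor+1$ and $r-s$ have length $\lfloor\frac{n-1}{r}\rfloor$, where $s=n-1-r\lfloor\frac{n-1}{r}\rfloor$ (length = number of edges). Also $S_{n,n-1}=S_n$, the star on $n$ vertices, and $S_{n,2}=P_n$, the path on $n$ vertices. *)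

theory Defs
  imports "Graph_Theory.Graph_Theory"
begin

text \<open>
  As in the library, a finite simple graph is a finite, symmetric, loop-free digraph whose arcs
  are pairs of vertices (\<^locale>\<open>pair_graph\<close>): each undirected edge \<open>uv\<close> is represented by the
  two arcs \<open>(u, v)\<close> and \<open>(v, u)\<close>.
\<close>

text \<open>
  The library's \<^const>\<open>tree\<close> cannot be used here: it forbids all directed cycles, and in a
  symmetric digraph traversing an edge back and forth is one. The cycles of the undirected graph
  are the directed cycles of length at least three.
\<close>

definition tree_graph :: "'a pair_pre_digraph \<Rightarrow> bool" where
  "tree_graph T \<longleftrightarrow> pair_graph T \<and> connected (with_proj T) \<and>
     \<not> (\<exists>p. pre_digraph.cycle (with_proj T) p \<and> 3 \<le> length p)"

definition gdist :: "'a pair_pre_digraph \<Rightarrow> 'a \<Rightarrow> 'a \<Rightarrow> ereal" where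
  "gdist G u v = wf_digraph.\<mu> (with_proj G) (\<lambda>_. 1) u v"

text \<open>The number \<open>n\<^sub>u\<close> with respect to the edge \<open>uv\<close>.\<close>

definition closer :: "'a pair_pre_digraph \<Rightarrow> 'a \<Rightarrow> 'a \<Rightarrow> nat" where
  "closer G u v = card {w \<in> pverts G. gdist G w u < gdist G w v}"

text \<open>
  The summand is symmetric in \<open>u\<close> and \<open>v\<close>, so the sum over all arcs counts every edge exactly
  twice and the division is exact; see \<open>Mostar_edges\<close> below.
\<close>

definition Mostar :: "'a pair_pre_digraph \<Rightarrow> int" where
  "Mostar G = (\<Sum>(u, v) \<in> parcs G. \<bar>int (closer G u v) - int (closer G v u)\<bar>) div 2"

lemma Mostar_edges:
  assumes "pair_graph G" "parcs G = A \<union> A\<inverse>" "A \<inter> A\<inverse> = {}"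
  shows "Mostar G = (\<Sum>(u, v) \<in> A. \<bar>int (closer G u v) - int (closer G v u)\<bar>)"
proof -
  interpret pair_graph G by fact
  let ?f = "\<lambda>(u, v). \<bar>int (closer G u v) - int (closer G v u)\<bar>"
  have "finite A" "finite (A\<inverse>)"
    using pair_finite_arcs assms(2) by (metis finite_Un)+
  then have "sum ?f (parcs G) = sum ?f A + sum ?f (A\<inverse>)"
    unfolding assms(2) using assms(3) by (rule sum.union_disjoint)
  also have "sum ?f (A\<inverse>) = sum ?f A"
    by (rule sum.reindex_bij_witness[of _ prod.swap prod.swap])
      (auto simp: abs_minus_commute)
  finally show ?thesis by (simp add: Mostar_def)
qed

text \<open>
  The class \<open>\<E>(n,t)\<close>, realised on vertices from an arbitrary type \<^typ>\<open>'a\<close>. The out-degree in the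
  symmetric digraph is the degree in the undirected graph.
\<close>

definition trees_deg2 :: "nat \<Rightarrow> nat \<Rightarrow> 'a pair_pre_digraph set" where
  "trees_deg2 n t = {T. tree_graph T \<and> card (pverts T) = n \<and>
     card {v \<in> pverts T. out_degree (with_proj T) v = 2} = t}"

text \<open>
  The spider with legs \<open>0, \<dots>, r - 1\<close> of lengths \<open>l 0, \<dots>, l (r - 1)\<close>: the centre is \<open>(0, 0)\<close>, and
  \<open>(i, j)\<close> with \<open>1 \<le> j \<le> l i\<close> is the vertex of leg \<open>i\<close> at distance \<open>j\<close> from the centre.
\<close>

definition spider_parent :: "nat \<times> nat \<Rightarrow> nat \<times> nat" where
  "spider_parent = (\<lambda>(i, j). if j = 1 then (0, 0) else (i, j - 1))"

definition spider :: "nat \<Rightarrow> (nat \<Rightarrow> nat) \<Rightarrow> (nat \<times> nat) pair_pre_digraph" where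
  "spider r l = (let L = (SIGMA i:{..<r}. {1..l i}) in
     \<lparr> pverts = insert (0, 0) L,
       parcs = (\<Union>x\<in>L. {(spider_parent x, x), (x, spider_parent x)}) \<rparr>)"

text \<open>
  The first \<open>s\<close> legs are the longer ones. For \<open>r = n - 1\<close> all legs have length one, which is the
  convention \<open>S\<^bsub>n,n-1\<^esub> = S\<^sub>n\<close>; see \<open>balanced_spider_star\<close> below.
\<close>

definition balanced_spider :: "nat \<Rightarrow> nat \<Rightarrow> (nat \<times> nat) pair_pre_digraph" where
  "balanced_spider n r = (let q = (n - 1) div r; s = n - 1 - r * q in
     spider r (\<lambda>i. if i < s then q + 1 else q))"

lemma balanced_spider_star:
  assumes "2 \<le> n"
  shows "balanced_spider n (n - 1) =
    \<lparr> pverts = insert (0, 0) ((\<lambda>i. (i, 1)) ` {..<n - 1}),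
      parcs = (\<Union>i<n - 1. {((0, 0), (i, 1)), ((i, 1), (0, 0))}) \<rparr>"
  using assms
  by (force simp: balanced_spider_def spider_def spider_parent_def Let_def image_iff)

lemma card_balanced_spider:
  assumes "1 \<le> r" "r \<le> n - 1"
  shows "card (pverts (balanced_spider n r)) = n"
proof -
  define q where "q = (n - 1) div r"
  define s where "s = n - 1 - r * q"
  let ?l = "\<lambda>i. if i < s then q + 1 else q"
  have s: "s = (n - 1) mod r"
    by (simp add: s_def q_def minus_mult_div_eq_mod)
  then have "s < r" using assms by simp
  have "(\<Sum>i<r. ?l i) = (\<Sum>i<r. q + (if i < s then 1 else 0))"
    by (rule sum.cong) auto
  also have "\<dots> = r * q + card {i\<in>{..<r}. i < s}"
    by (simp add: sum.distrib sum.If_cases Int_def)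
  also have "{i\<in>{..<r}. i < s} = {..<s}" using \<open>s < r\<close> by auto
  finally have "(\<Sum>i<r. ?l i) = n - 1"
    by (simp add: s q_def)
  moreover have "card (pverts (balanced_spider n r)) = Suc (\<Sum>i<r. ?l i)"
    unfolding balanced_spider_def Let_def q_def[symmetric] s_def[symmetric]
    by (simp add: spider_def Let_def card_insert_if)
  ultimately show ?thesis using assms by simp
qed

end

theory Submission
  imports Defs
begin

text \<open>
  In a tree rooted at a centroid \<open>c\<close>, no branch contains more than half of the vertices, so the
  Mostar index is \<open>n (n - 1) - 2 D\<close>, where \<open>D\<close> is the sum of all distances to \<open>c\<close>; for an
  arbitrary root this expression is a lower bound. Maximising the index thus means minimising \<open>D\<close>.
  A tree with \<open>t \<le> n - 4\<close> vertices of degree two is not a path, hence has at most \<open>r = n - t - 1\<close>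
  leaves, and since distinct vertices of one level have distinct leaves below them, each level
  contains at most \<open>r\<close> vertices. So \<open>D\<close> is minimal precisely if the levels are filled with \<open>r\<close>
  vertices one after the other, which the balanced spider achieves. In that case the root has \<open>r\<close>
  children. The other \<open>n - 1 - r = t\<close> non-root vertices are children of non-root vertices, and the
  \<open>t\<close> vertices of degree two already account for one child each, so only the root branches.
\<close>

section \<open>Rooted trees\<close>

definition tree_of :: "'a set \<Rightarrow> 'a \<Rightarrow> ('a \<Rightarrow> 'a) \<Rightarrow> 'a pair_pre_digraph" where
  "tree_of V c p = \<lparr> pverts = V, parcs = (\<Union>v\<in>V - {c}. {(p v, v), (v, p v)}) \<rparr>"

text \<open>The depth \<open>d\<close> is part of the data because
  \<open>d v = Suc (d (p v))\<close> excludes cyclic parent pointers and makes every vertex reach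
  \<open>c\<close>. With \<open>p c = c\<close> the iterates of \<open>p\<close> stay at the root,
  which matches truncated subtraction of depths.\<close>

locale rooted_tree =
  fixes V :: "'a set" and c :: 'a and p :: "'a \<Rightarrow> 'a" and d :: "'a \<Rightarrow> nat"
  assumes finite_V: "finite V"
    and root_in: "c \<in> V"
    and p_root: "p c = c"
    and d_root: "d c = 0"
    and parent: "\<And>v. v \<in> V \<Longrightarrow> v \<noteq> c \<Longrightarrow> p v \<in> V \<and> d v = Suc (d (p v))"
begin

abbreviation G :: "'a pair_pre_digraph" where "G \<equiv> tree_of V c p"

lemma p_in: "v \<in> V \<Longrightarrow> p v \<in> V"
  using parent p_root root_in by (cases "v = c") auto

lemma d_p: "v \<in> V \<Longrightarrow> d (p v) = d v - 1"
  using parent[of v] p_root d_root by (cases "v = c") auto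

lemma d_eq_0: "v \<in> V \<Longrightarrow> d v = 0 \<longleftrightarrow> v = c"
  using parent[of v] d_root by (metis nat.distinct(1))

lemma p_neq: "v \<in> V \<Longrightarrow> v \<noteq> c \<Longrightarrow> p v \<noteq> v"
  using parent[of v] by (metis n_not_Suc_n)

lemma iter_in: "v \<in> V \<Longrightarrow> (p ^^ k) v \<in> V"
  by (induction k) (auto intro: p_in)

lemma d_iter: "v \<in> V \<Longrightarrow> d ((p ^^ k) v) = d v - k"
  by (induction k) (auto simp: d_p iter_in)

lemma in_arcs: "(x, y) \<in> parcs G \<longleftrightarrow>
    (y \<in> V \<and> y \<noteq> c \<and> x = p y) \<or> (x \<in> V \<and> x \<noteq> c \<and> y = p x)"
  by (auto simp: tree_of_def)

lemma pverts_G [simp]: "pverts G = V"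
  by (simp add: tree_of_def)

lemma pair_graph_G: "pair_graph G"
proof
  show "finite (parcs G)"
    using finite_V by (auto simp: tree_of_def)
  show "symmetric (with_proj G)"
    by (auto simp: symmetric_def sym_def in_arcs)
  show "fst e \<noteq> snd e" if "e \<in> parcs G" for e
    using that by (cases e) (auto simp: in_arcs dest: p_neq)
qed (auto simp: finite_V in_arcs p_in)

lemma reachable_root: "v \<in> V \<Longrightarrow> v \<rightarrow>\<^sup>*\<^bsub>with_proj G\<^esub> c"
proof (induction "d v" arbitrary: v)
  case 0
  interpret pair_graph G by (rule pair_graph_G)
  from 0 have "v = c" using d_eq_0 by simp
  then show ?case using root_in by simp
next
  case (Suc n)
  interpret pair_graph G by (rule pair_graph_G)
  from Suc have "v \<noteq> c" using d_root by auto
  then have "(v, p v) \<in> parcs G" using Suc.prems by (simp add: in_arcs)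
  moreover have "p v \<rightarrow>\<^sup>*\<^bsub>with_proj G\<^esub> c"
    using Suc by (simp add: d_p p_in)
  ultimately show ?case by (simp add: adj_reachable_trans)
qed

lemma reachable_G:
  assumes "u \<in> V" "v \<in> V"
  shows "u \<rightarrow>\<^sup>*\<^bsub>with_proj G\<^esub> v"
proof -
  interpret pair_graph G by (rule pair_graph_G)
  have "c \<rightarrow>\<^sup>*\<^bsub>with_proj G\<^esub> v"
    using reachable_root[OF assms(2)] by (rule symmetric_reachable')
  with reachable_root[OF assms(1)] show ?thesis by (rule reachable_trans)
qed

lemma neighbour_of_deep:
  assumes "(x, y) \<in> parcs G \<or> (y, x) \<in> parcs G" "d x \<le> d y"
  shows "x = p y"
  using assms parent[of x] by (metis in_arcs Suc_n_not_le_n)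

text \<open>A cycle runs through the parent of its deepest vertex both before and after that vertex.\<close>

lemma no_cycle:
  assumes "pre_digraph.cycle (with_proj G) q"
  shows "length q < 3"
proof (rule ccontr)
  assume len: "\<not> length q < 3"
  interpret pair_graph G by (rule pair_graph_G)
  from assms obtain u where w: "awalk u q u" and dist: "distinct (tl (pawalk_verts u q))"
    by (auto simp: cycle_def)
  have sub: "set q \<subseteq> parcs G" and cas: "pcas u q u"
    using w by auto
  have "pawalk_verts u q = fst (hd q) # map snd q"
    using awalk_verts_conv'[OF cas] len by auto
  with dist have dist: "distinct (map snd q)" by simp
  have "q \<noteq> []" using len by auto
  define m where "m = Max ((d \<circ> snd) ` set q)"
  have "m \<in> (d \<circ> snd) ` set q"
    unfolding m_def using \<open>q \<noteq> []\<close> by (intro Max_in) auto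
  then obtain e where e: "e \<in> set q" "d (snd e) = m" by auto
  have max: "d (snd f) \<le> m" if "f \<in> set q" for f
    unfolding m_def using that by (intro Max_ge) auto
  obtain xs ys where q: "q = xs @ e # ys"
    using e(1) by (auto simp: in_set_conv_decomp)
  \<comment> \<open>The cycle is rotated so that it starts and ends at a deepest vertex. Its first
    arc \<open>f\<close> and its last but one arc \<open>g\<close> have different positions since
    the length is at least three, yet both end in the parent of that vertex.\<close>
  define q' where "q' = ys @ xs @ [e]"
  have w': "awalk (snd e) q' (snd e)"
    using w unfolding q q'_def by (auto simp: awalk_simps intro!: awalk_appendI)
  have len': "length q' \<ge> 3" and dist': "distinct (map snd q')" and set': "set q' = set q"
    using len dist unfolding q q'_def by auto
  then obtain f r' where "ys @ xs = f # r'" by (cases "ys @ xs") (auto simp: q'_def)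
  then have q': "q' = f # r' @ [e]" by (simp add: q'_def)
  with len' obtain r'' g where r': "r' = r'' @ [g]"
    by (cases r' rule: rev_cases) auto
  have "fst f = snd e" "snd g = fst e"
    using w' unfolding q' r' by (auto simp: awalk_Cons_iff awalk_def)
  moreover have "f \<in> parcs G" "e \<in> parcs G" "d (snd f) \<le> d (snd e)" "d (snd g) \<le> d (snd e)"
    using sub max[of f] max[of g] e unfolding set'[symmetric] q' r' by auto
  ultimately have "snd f = p (snd e)" "snd g = p (snd e)"
    using neighbour_of_deep[of "snd f" "snd e"] neighbour_of_deep[of "snd g" "snd e"]
    by (metis prod.collapse)+
  with dist' show False unfolding q' r' by simp
qed

lemma tree_graph_G: "tree_graph G"
proof -
  interpret pair_graph G by (rule pair_graph_G)
  have "connected (with_proj G)"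
    unfolding connected_def
    using root_in reachable_G
    by (intro strongly_connectedI) (auto simp: reachable_mk_symmetric_eq[OF pair_sym_arcs])
  with no_cycle pair_graph_G show ?thesis
    unfolding tree_graph_def by (meson not_le)
qed

end

text \<open>\<open>d\<close> is the distance to \<open>c\<close>, and \<open>p\<close> picks a
  neighbour one step closer. These arcs already connect all vertices, so any further arc of
  \<open>T\<close> would close a cycle.\<close>

lemma tree_graph_rooted:
  fixes T :: "'a pair_pre_digraph"
  assumes T: "tree_graph T" and c: "c \<in> pverts T"
  obtains p d where "rooted_tree (pverts T) c p d" "T = tree_of (pverts T) c p"
proof -
  let ?V = "pverts T"
  from T interpret T: pair_graph T by (simp add: tree_graph_def)
  from T have conn: "strongly_connected (with_proj T)"
    using T.symmetric_connected_imp_strongly_connected[OF T.pair_sym_arcs]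
    by (simp add: tree_graph_def)
  define d where "d v = (LEAST n. \<exists>q. T.awalk v q c \<and> length q = n)" for v
  have d_le: "d v \<le> length q" if "T.awalk v q c" for v q
    unfolding d_def using that by (auto intro: Least_le)
  have d_ex: "\<exists>q. T.awalk v q c \<and> length q = d v" if "v \<in> ?V" for v
  proof -
    have "v \<rightarrow>\<^sup>*\<^bsub>with_proj T\<^esub> c"
      using conn that c by auto
    then obtain q where "T.awalk v q c" by (auto simp: T.reachable_awalk)
    then show ?thesis unfolding d_def
      by (intro LeastI_ex[of "\<lambda>n. \<exists>q. T.awalk v q c \<and> length q = n"]) auto
  qed
  have step: "\<exists>x. (v, x) \<in> parcs T \<and> d v = Suc (d x)" if v: "v \<in> ?V" "v \<noteq> c" for v
  proof -
    obtain q where q: "T.awalk v q c" "length q = d v" using d_ex v(1) by blast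
    with v(2) obtain e es where es: "q = e # es" by (cases q) (auto simp: T.awalk_Nil_iff)
    with q have e: "e \<in> parcs T" "fst e = v" "T.awalk (snd e) es c"
      by (auto simp: T.awalk_Cons_iff)
    have "d (snd e) \<le> length es" using d_le e(3) by blast
    moreover obtain q' where q': "T.awalk (snd e) q' c" "length q' = d (snd e)"
      using d_ex[of "snd e"] e(3) by auto
    have "T.awalk v (e # q') c" using e q' by (simp add: T.awalk_Cons_iff)
    from d_le[OF this] have "d v \<le> Suc (d (snd e))" using q'(2) by simp
    ultimately have "d v = Suc (d (snd e))" using q(2) es by simp
    with e show ?thesis by (metis prod.collapse)
  qed
  define p where "p v = (if v = c then c else SOME x. (v, x) \<in> parcs T \<and> d v = Suc (d x))" for v
  have p: "(v, p v) \<in> parcs T \<and> d v = Suc (d (p v))" if "v \<in> ?V" "v \<noteq> c" for v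
    using someI_ex[OF step[OF that]] that(2) by (simp add: p_def)
  have "d c = 0" using c d_le[of c "[]"] by (simp add: T.awalk_Nil_iff)
  then have rt: "rooted_tree ?V c p d"
    using T.pair_finite_verts c p T.in_arcsD2
    by unfold_locales (auto simp: p_def)
  then interpret H: rooted_tree ?V c p d .
  interpret Hg: pair_graph H.G by (rule H.pair_graph_G)
  have sym: "(y, x) \<in> parcs T" if "(x, y) \<in> parcs T" for x y
    using T.pair_sym_arcs that by (auto simp: symmetric_def sym_def)
  have HT: "parcs H.G \<subseteq> parcs T"
    using p sym by (auto simp: H.in_arcs)
  have TH: "(u, v) \<in> parcs H.G" if uv: "(u, v) \<in> parcs T" for u v
  proof (rule ccontr)
    assume nH: "(u, v) \<notin> parcs H.G"
    have V: "u \<in> ?V" "v \<in> ?V" using uv T.in_arcsD1 T.in_arcsD2 by auto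
    have "v \<rightarrow>\<^sup>*\<^bsub>with_proj H.G\<^esub> u" using H.reachable_G V by simp
    then obtain q where q: "Hg.apath v q u" using Hg.reachable_apath by blast
    then have q': "Hg.awalk v q u" "distinct (pawalk_verts v q)"
      by (auto simp: Hg.apath_def)
    have "T.awalk v q u"
      using q'(1) HT V by (auto simp: Hg.awalk_def T.awalk_def)
    then have "T.awalk u ((u, v) # q) u" using uv by (simp add: T.awalk_Cons_iff)
    then have "T.cycle ((u, v) # q)"
      using q'(2) by (auto simp: T.cycle_def)
    \<comment> \<open>\<open>tree_graph\<close> only excludes cycles of length at least three. A
      shorter path back would make \<open>(u, v)\<close> a loop or the reverse of an arc of
      \<open>H.G\<close>.\<close>
    moreover have "length q \<ge> 2"
    proof (rule ccontr)
      assume "\<not> length q \<ge> 2"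
      then consider "q = []" | e where "q = [e]"
        by (cases q; cases "tl q") auto
      then show False
      proof cases
        case 1
        then have "u = v" using q'(1) by (auto simp: Hg.awalk_Nil_iff)
        then show False using T.pair_no_loops uv by force
      next
        case 2
        then have "(v, u) \<in> parcs H.G"
          using q'(1) by (cases e) (auto simp: Hg.awalk_simps)
        then show False using nH by (auto simp: H.in_arcs)
      qed
    qed
    ultimately show False using T unfolding tree_graph_def by fastforce
  qed
  have "parcs T = parcs H.G" using HT TH by auto
  then have "T = H.G" by (simp add: tree_of_def pair_pre_digraph.equality)
  with rt show thesis by (rule that)
qed

section \<open>The Mostar index of a rooted tree\<close>

text \<open>The distance is an infimum of extended reals over all walks. Lengths are natural
  numbers, so the infimum is attained and distances can be compared through shortest walks.\<close>

lemma gdist_attained: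
  assumes wf: "wf_digraph (with_proj G)" and ex: "pre_digraph.awalk (with_proj G) u q0 v"
  shows "\<exists>q. pre_digraph.awalk (with_proj G) u q v \<and> gdist G u v = ereal (length q) \<and>
    (\<forall>q'. pre_digraph.awalk (with_proj G) u q' v \<longrightarrow> length q \<le> length q')"
proof -
  interpret wf_digraph "with_proj G" by (rule wf)
  obtain q where q: "awalk u q v" "\<And>q'. awalk u q' v \<Longrightarrow> length q \<le> length q'"
    using ex_has_least_nat[of "\<lambda>q. awalk u q v" q0 length] ex by blast
  have cost: "awalk_cost (\<lambda>_. 1) q' = length q'" for q'
    by (induction q') auto
  have "gdist G u v = ereal (length q)"
    unfolding gdist_def \<mu>_def cost
    by (rule INF_eqI) (use q in auto)
  with q show ?thesis by blast
qed

text \<open>The walk must use an arc leaving \<open>A\<close>, and such an arc starts in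
  \<open>a\<close>. The part before it is shorter by at least this arc.\<close>

lemma (in wf_digraph) awalk_leaves_through:
  assumes "awalk w q y" "w \<in> A" "y \<notin> A"
    and "\<And>e. e \<in> arcs G \<Longrightarrow> tail G e \<in> A \<Longrightarrow> head G e \<notin> A \<Longrightarrow> tail G e = a"
  shows "\<exists>q'. awalk w q' a \<and> length q' < length q"
  using assms(1,2)
proof (induction q arbitrary: w)
  case Nil
  then show ?case using assms(3) by (simp add: awalk_Nil_iff)
next
  case (Cons e es)
  then have e: "e \<in> arcs G" "tail G e = w" "awalk (head G e) es y"
    by (auto simp: awalk_Cons_iff)
  show ?case
  proof (cases "head G e \<in> A")
    case True
    then obtain q' where "awalk (head G e) q' a" "length q' < length es"
      using Cons.IH e(3) by blast
    then show ?thesis using e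
      by (intro exI[of _ "e # q'"]) (simp add: awalk_Cons_iff)
  next
    case False
    then have "w = a" using assms(4)[OF e(1)] e(2) Cons.prems(2) by simp
    then show ?thesis using Cons.prems(1)
      by (intro exI[of _ "[]"]) (auto simp: awalk_Nil_iff)
  qed
qed

section \<open>Subtrees and the two sides of an edge\<close>

context rooted_tree
begin

definition desc :: "'a \<Rightarrow> 'a set" where
  "desc v = {w \<in> V. \<exists>k. (p ^^ k) w = v}"

definition children :: "'a \<Rightarrow> 'a set" where
  "children v = {w \<in> V - {c}. p w = v}"

lemma desc_subset: "desc v \<subseteq> V"
  by (auto simp: desc_def)

lemma finite_desc [simp]: "finite (desc v)"
  using desc_subset finite_V by (rule finite_subset)

lemma finite_children [simp]: "finite (children v)"
  using finite_V by (simp add: children_def)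

lemma self_desc: "v \<in> V \<Longrightarrow> v \<in> desc v"
  by (auto simp: desc_def intro: funpow_0)

lemma desc_depth: "w \<in> desc v \<Longrightarrow> d v \<le> d w"
  by (auto simp: desc_def d_iter)

lemma parent_not_desc: "v \<in> V \<Longrightarrow> v \<noteq> c \<Longrightarrow> p v \<notin> desc v"
  using parent[of v] desc_depth[of "p v" v] by auto

lemma desc_if_parent_desc: "w \<in> V \<Longrightarrow> p w \<in> desc v \<Longrightarrow> w \<in> desc v"
proof -
  assume w: "w \<in> V" and "p w \<in> desc v"
  then obtain k where "(p ^^ Suc k) w = v" by (auto simp: desc_def funpow_swap1)
  with w show ?thesis unfolding desc_def by blast
qed

lemma parent_desc:
  assumes "w \<in> desc v" "w \<noteq> v" shows "p w \<in> desc v"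
proof -
  from assms obtain k where "w \<in> V" "(p ^^ k) w = v" by (auto simp: desc_def)
  moreover with assms(2) obtain k' where "k = Suc k'" by (cases k) auto
  ultimately show ?thesis by (auto simp: desc_def p_in funpow_swap1)
qed

lemma desc_child_subset: "desc w \<subseteq> desc (p w)"
proof
  fix x assume "x \<in> desc w"
  then obtain k where "x \<in> V" "(p ^^ Suc k) x = p w" by (auto simp: desc_def)
  then show "x \<in> desc (p w)" unfolding desc_def by blast
qed

text \<open>A shortest walk from \<open>w\<close> to \<open>x\<close> has to leave \<open>A\<close>
  and thus visits \<open>a\<close> strictly before its end.\<close>

lemma gdist_less:
  assumes "w \<in> A" "x \<notin> A" "w \<in> V" "x \<in> V"
    and "\<And>y z. (y, z) \<in> parcs G \<Longrightarrow> y \<in> A \<Longrightarrow> z \<notin> A \<Longrightarrow> y = a"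
  shows "gdist G w a < gdist G w x"
proof -
  interpret pair_graph G by (rule pair_graph_G)
  obtain q0 where "awalk w q0 x"
    using reachable_G[OF assms(3,4)] reachable_awalk by blast
  then obtain q where q: "awalk w q x" "gdist G w x = ereal (length q)"
    using gdist_attained[OF wf_digraph_axioms] by blast
  obtain q1 where q1: "awalk w q1 a" "length q1 < length q"
    using awalk_leaves_through[OF q(1) assms(1,2), of a] assms(5) by auto
  obtain q2 where q2: "awalk w q2 a" "gdist G w a = ereal (length q2)"
    "\<And>q'. awalk w q' a \<Longrightarrow> length q2 \<le> length q'"
    using gdist_attained[OF wf_digraph_axioms q1(1)] by blast
  have "length q2 < length q" using q2(3)[OF q1(1)] q1(2) by simp
  with q q2 show ?thesis by simp
qed

text \<open>The edge between \<open>v\<close> and \<open>p v\<close> is the only one between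
  \<open>desc v\<close> and the remaining vertices, so \<open>gdist_less\<close> applies with either
  side as \<open>A\<close>.\<close>

lemma gdist_desc:
  assumes v: "v \<in> V" "v \<noteq> c" and w: "w \<in> V"
  shows "w \<in> desc v \<Longrightarrow> gdist G w v < gdist G w (p v)"
    and "w \<notin> desc v \<Longrightarrow> gdist G w (p v) < gdist G w v"
proof -
  show "gdist G w v < gdist G w (p v)" if "w \<in> desc v"
    using that parent_not_desc[OF v] w p_in[OF v(1)]
    by (rule gdist_less) (auto simp: in_arcs dest: desc_if_parent_desc parent_desc)
  have "gdist G w (p v) < gdist G w v" if "w \<in> V - desc v"
    using that _ w v(1)
  proof (rule gdist_less)
    show "v \<notin> V - desc v" using self_desc v by simp
    show "y = p v" if "(y, z) \<in> parcs G" "y \<in> V - desc v" "z \<notin> V - desc v" for y z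
      using that p_in[of y] desc_if_parent_desc[of y v] parent_desc[of z v]
      by (auto simp: in_arcs)
  qed
  with w show "gdist G w (p v) < gdist G w v" if "w \<notin> desc v" using that by simp
qed

lemma closer_parent:
  assumes "v \<in> V" "v \<noteq> c"
  shows "closer G v (p v) = card (desc v)"
    and "closer G (p v) v = card V - card (desc v)"
proof -
  have "{w \<in> V. gdist G w v < gdist G w (p v)} = desc v"
    using gdist_desc[OF assms] desc_subset[of v] by (fastforce dest: less_asym)
  then show "closer G v (p v) = card (desc v)" by (simp add: closer_def)
  have "{w \<in> V. gdist G w (p v) < gdist G w v} = V - desc v"
    using gdist_desc[OF assms] by (fastforce dest: less_asym)
  then show "closer G (p v) v = card V - card (desc v)"
    by (simp add: closer_def card_Diff_subset desc_subset)
qed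

lemma Mostar_G: "Mostar G = (\<Sum>v\<in>V - {c}. \<bar>int (card V) - 2 * int (card (desc v))\<bar>)"
proof -
  \<comment> \<open>\<open>A\<close> orients each edge towards the root, so each non-root vertex
    stands for exactly one edge.\<close>
  define A where "A = (\<lambda>v. (v, p v)) ` (V - {c})"
  have "parcs G = A \<union> A\<inverse>"
    unfolding A_def tree_of_def by auto
  moreover have "A \<inter> A\<inverse> = {}"
  proof (rule equals0I)
    fix e assume "e \<in> A \<inter> A\<inverse>"
    then obtain v w where vw: "v \<in> V" "v \<noteq> c" "w \<in> V" "w \<noteq> c" "v = p w" "w = p v"
      unfolding A_def by blast
    then have "d v = Suc (d w)" "d w = Suc (d v)" using parent[of v] parent[of w] by metis+
    then show False by simp
  qed
  ultimately have "Mostar G = (\<Sum>(u, v)\<in>A. \<bar>int (closer G u v) - int (closer G v u)\<bar>)"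
    by (rule Mostar_edges[OF pair_graph_G])
  also have "\<dots> = (\<Sum>v\<in>V - {c}. \<bar>int (closer G v (p v)) - int (closer G (p v) v)\<bar>)"
    unfolding A_def by (subst sum.reindex) (auto simp: inj_on_def)
  also have "\<dots> = (\<Sum>v\<in>V - {c}. \<bar>int (card V) - 2 * int (card (desc v))\<bar>)"
    using card_mono[OF finite_V desc_subset]
    by (intro sum.cong) (auto simp: closer_parent of_nat_diff)
  finally show ?thesis .
qed

text \<open>The counted vertices form the path from \<open>w\<close> upwards, root excluded:
  \<open>w\<close> itself and those counted for its parent.\<close>

lemma card_ancestors: "w \<in> V \<Longrightarrow> card {v \<in> V - {c}. w \<in> desc v} = d w"
proof (induction "d w" arbitrary: w)
  case 0
  then have "w = c" using d_eq_0 by simp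
  then have "{v \<in> V - {c}. w \<in> desc v} = {}"
    using desc_depth[of c] d_root d_eq_0 desc_depth[of w] 0 by fastforce
  then show ?case using 0 by (metis card.empty)
next
  case (Suc n)
  then have w: "w \<noteq> c" using d_root by auto
  have "{v \<in> V - {c}. w \<in> desc v} = insert w {v \<in> V - {c}. p w \<in> desc v}"
    using w Suc.prems self_desc desc_if_parent_desc parent_desc by auto
  moreover have "card {v \<in> V - {c}. p w \<in> desc v} = n"
    using Suc by (simp add: d_p p_in)
  moreover have "p w \<notin> desc w" using parent_not_desc w Suc.prems by simp
  ultimately show ?case using Suc.hyps(2) finite_V by simp
qed

text \<open>Double counting of the pairs \<open>(v, w)\<close> with
  \<open>w \<in> desc v\<close>.\<close>

lemma sum_card_desc: "(\<Sum>v\<in>V - {c}. card (desc v)) = (\<Sum>v\<in>V. d v)"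
proof -
  have "(\<Sum>v\<in>V - {c}. card (desc v)) = (\<Sum>v\<in>V - {c}. \<Sum>w\<in>V. if w \<in> desc v then 1 else 0)"
    using desc_subset finite_V by (intro sum.cong) (auto simp: Int_absorb1 simp flip: sum.inter_restrict)
  also have "\<dots> = (\<Sum>w\<in>V. \<Sum>v\<in>V - {c}. if w \<in> desc v then 1 else 0)"
    by (rule sum.swap)
  also have "\<dots> = (\<Sum>w\<in>V. d w)"
    using finite_V by (intro sum.cong) (simp_all add: card_ancestors[simplified] flip: sum.inter_filter)
  finally show ?thesis .
qed

text \<open>Without absolute values the sum is linear in the subtree sizes. This gives the lower
  bound for every root, and the exact value once all summands are nonnegative.\<close>

lemma sum_signed_differences:
  "(\<Sum>v\<in>V - {c}. int (card V) - 2 * int (card (desc v)))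
    = int (card V) * (int (card V) - 1) - 2 * int (\<Sum>v\<in>V. d v)"
proof -
  have "card (V - {c}) = card V - 1" "0 < card V"
    using root_in finite_V card_gt_0_iff by auto
  then have "(\<Sum>v\<in>V - {c}. int (card V)) = int (card V) * (int (card V) - 1)"
    by (simp add: of_nat_diff algebra_simps)
  moreover have "(\<Sum>v\<in>V - {c}. 2 * int (card (desc v))) = 2 * int (\<Sum>v\<in>V. d v)"
    by (simp add: sum_distrib_left flip: sum_card_desc)
  ultimately show ?thesis by (simp only: sum_subtractf)
qed

lemma Mostar_ge: "Mostar G \<ge> int (card V) * (int (card V) - 1) - 2 * int (\<Sum>v\<in>V. d v)"
proof -
  have "(\<Sum>v\<in>V - {c}. int (card V) - 2 * int (card (desc v))) \<le> Mostar G"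
    unfolding Mostar_G by (rule sum_mono) (rule abs_ge_self)
  then show ?thesis by (simp only: sum_signed_differences)
qed

lemma Mostar_eq:
  assumes "\<And>v. v \<in> V - {c} \<Longrightarrow> 2 * card (desc v) \<le> card V"
  shows "Mostar G = int (card V) * (int (card V) - 1) - 2 * int (\<Sum>v\<in>V. d v)"
  unfolding Mostar_G sum_signed_differences[symmetric]
proof (rule sum.cong)
  fix v assume "v \<in> V - {c}"
  from assms[OF this]
  show "\<bar>int (card V) - 2 * int (card (desc v))\<bar> = int (card V) - 2 * int (card (desc v))"
    by linarith
qed simp

text \<open>Climbing from \<open>v\<close> ends in the child of the root whose branch contains
  \<open>v\<close>, and subtrees only grow on the way. Thus a subtree with more than half of the
  vertices yields such a branch.\<close>

lemma closer_child_of_root: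
  assumes "v \<in> V - {c}"
  shows "\<exists>u\<in>V. (u, c) \<in> parcs G \<and> desc v \<subseteq> desc u"
  using assms
proof (induction "d v" arbitrary: v)
  case 0
  then show ?case using d_eq_0[of v] by auto
next
  case (Suc n)
  show ?case
  proof (cases "p v = c")
    case True
    then show ?thesis using Suc.prems by (intro bexI[of _ v]) (auto simp: in_arcs)
  next
    case False
    then have "\<exists>u\<in>V. (u, c) \<in> parcs G \<and> desc (p v) \<subseteq> desc u"
      using Suc by (intro Suc.hyps(1)) (auto simp: d_p p_in)
    then show ?thesis using desc_child_subset[of v] by blast
  qed
qed

end

text \<open>If no vertex is a centroid, each vertex has a neighbour towards the heavier side. The
  heavier sides shrink strictly along these neighbours, which is impossible.\<close>

lemma centroid_exists:
  fixes T :: "'a pair_pre_digraph"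
  assumes T: "tree_graph T"
  shows "\<exists>c p d. rooted_tree (pverts T) c p d \<and> T = tree_of (pverts T) c p \<and>
    (\<forall>v \<in> pverts T - {c}. 2 * card (rooted_tree.desc (pverts T) p v) \<le> card (pverts T))"
proof (rule ccontr)
  assume none: "\<not> ?thesis"
  let ?V = "pverts T" and ?n = "card (pverts T)"
  have heavy: "\<exists>u\<in>?V. (u, c) \<in> parcs T \<and> ?n < 2 * closer T u c" if c: "c \<in> ?V" for c
  proof -
    obtain p d where rt: "rooted_tree ?V c p d" and eq: "T = tree_of ?V c p"
      using tree_graph_rooted[OF T c] .
    interpret rooted_tree ?V c p d by (rule rt)
    obtain v where v: "v \<in> ?V - {c}" "?n < 2 * card (desc v)"
      using none rt eq by (meson not_le)
    obtain u where u: "u \<in> ?V" "(u, c) \<in> parcs G" "desc v \<subseteq> desc u"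
      using closer_child_of_root v(1) by blast
    then have "u \<noteq> c" "p u = c" using p_neq[of u] p_root by (auto simp: in_arcs dest: p_neq)
    then have "closer T u c = card (desc u)"
      using closer_parent(1)[of u] u(1) eq[symmetric] by simp
    moreover have "card (desc v) \<le> card (desc u)" using u(3) by (simp add: card_mono)
    ultimately show ?thesis using u v eq[symmetric] by auto
  qed
  \<comment> \<open>\<open>P (u, c)\<close> means that \<open>u\<close> is a neighbour of
    \<open>c\<close> whose side of the edge holds more than half of the vertices; a pair with the
    smallest such side is chosen.\<close>
  define P where "P = (\<lambda>(u, c). c \<in> ?V \<and> (u, c) \<in> parcs T \<and> ?n < 2 * closer T u c)"
  from T have "?V \<noteq> {}"
    by (auto simp: tree_graph_def connected_conv)
  then obtain c0 where c0: "c0 \<in> ?V" by blast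
  with heavy obtain u0 where "u0 \<in> ?V" "(u0, c0) \<in> parcs T" "?n < 2 * closer T u0 c0" by blast
  with c0 have "P (u0, c0)" by (simp add: P_def)
  then obtain u c where uc: "P (u, c)" and min: "\<And>u' c'. P (u', c') \<Longrightarrow> closer T u c \<le> closer T u' c'"
    using ex_has_least_nat[of P "(u0, c0)" "\<lambda>(u, c). closer T u c"] by fastforce
  then have c: "c \<in> ?V" by (simp add: P_def)
  obtain p d where rt: "rooted_tree ?V c p d" and eq: "T = tree_of ?V c p"
    using tree_graph_rooted[OF T c] .
  interpret rooted_tree ?V c p d by (rule rt)
  have arc: "(u, c) \<in> parcs G" using uc eq[symmetric] by (simp add: P_def)
  then have u: "u \<in> ?V" "u \<noteq> c" "p u = c" using p_neq[of u] p_root by (auto simp: in_arcs dest: p_neq)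
  obtain w where w: "w \<in> ?V" "(w, u) \<in> parcs T" "?n < 2 * closer T w u"
    using heavy u(1) by blast
  have n_uc: "?n < 2 * closer G u c" using uc eq[symmetric] by (simp add: P_def)
  \<comment> \<open>Otherwise both sides of the edge between \<open>u\<close> and \<open>c\<close>
    would contain more than half of the vertices.\<close>
  have "w \<noteq> c"
  proof
    assume "w = c"
    then show False
      using w(3) n_uc closer_parent[OF u(1,2)] u(3) card_mono[OF finite_V desc_subset[of u]] eq[symmetric] by simp
  qed
  have "(w, u) \<in> parcs G" using w(2) by (simp flip: eq)
  with \<open>w \<noteq> c\<close> u(3) have pw: "p w = u" by (auto simp: in_arcs)
  have "P (w, u)" using w u by (simp add: P_def)
  from min[OF this] have "card (desc u) \<le> card (desc w)"
    using closer_parent(1)[OF u(1,2)] closer_parent(1)[OF w(1) \<open>w \<noteq> c\<close>] u(3) pw eq[symmetric] by simp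
  moreover have "desc w \<subset> desc u"
    using desc_child_subset[of w] self_desc[OF u(1)] parent_not_desc[OF w(1) \<open>w \<noteq> c\<close>] pw by auto
  then have "card (desc w) < card (desc u)" by (rule psubset_card_mono[OF finite_desc])
  ultimately show False by simp
qed

section \<open>Degrees, leaves and levels\<close>

context rooted_tree
begin

abbreviation deg2 :: "'a set" where
  "deg2 \<equiv> {v \<in> V. out_degree (with_proj G) v = 2}"

definition level :: "nat \<Rightarrow> 'a set" where
  "level j = {v \<in> V. d v = j}"

definition leaves :: "'a set" where
  "leaves = {v \<in> V - {c}. children v = {}}"

lemma finite_level [simp]: "finite (level j)"
  using finite_V by (simp add: level_def)

lemma finite_leaves [simp]: "finite leaves"
  using finite_V by (simp add: leaves_def)

lemma level_1: "level 1 = children c"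
proof
  show "level 1 \<subseteq> children c"
    using d_root by (auto simp: level_def children_def d_p p_in simp flip: d_eq_0)
  show "children c \<subseteq> level 1"
    using d_root parent by (auto simp: level_def children_def)
qed

lemma out_degree_G:
  assumes "v \<in> V"
  shows "out_degree (with_proj G) v = card (children v) + (if v = c then 0 else 1)"
proof -
  have "out_arcs (with_proj G) v = Pair v ` (children v \<union> (if v = c then {} else {p v}))"
    using assms unfolding out_arcs_def children_def tree_of_def by auto
  then have "out_degree (with_proj G) v = card (children v \<union> (if v = c then {} else {p v}))"
    by (simp add: out_degree_def card_image inj_on_def)
  also have "\<dots> = card (children v) + (if v = c then 0 else 1)"
  proof (cases "v = c")
    case False
    then have "p v \<notin> children v"
      using assms parent[of v] parent[of "p v"] by (auto simp: children_def)
    then show ?thesis using False by simp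
  qed simp
  finally show ?thesis .
qed

lemma sum_children: "(\<Sum>v\<in>V. card (children v)) = card V - 1"
proof -
  have "V - {c} = (\<Union>v\<in>V. children v)" by (auto simp: children_def p_in)
  moreover have "card (\<Union>v\<in>V. children v) = (\<Sum>v\<in>V. card (children v))"
    using finite_V by (intro card_UN_disjoint) (auto simp: children_def)
  ultimately show ?thesis
    using root_in finite_V by (metis card_Diff_singleton)
qed

lemma card_V_children: "card V = Suc (card (children c) + (\<Sum>v\<in>V - {c}. card (children v)))"
proof -
  have "0 < card V" using root_in finite_V card_gt_0_iff by blast
  moreover have "(\<Sum>v\<in>V. card (children v)) = card (children c) + (\<Sum>v\<in>V - {c}. card (children v))"
    by (rule sum.remove[OF finite_V root_in])
  ultimately show ?thesis using sum_children by linarith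
qed

text \<open>Some vertex is neither a leaf nor of degree two. Otherwise the root has two children and
  every other vertex of \<open>deg2\<close> has one, so \<open>card V = card deg2 + 2\<close>, as in
  a path; the hypothesis excludes this.\<close>

lemma card_leaves_le:
  assumes "card deg2 + 4 \<le> card V"
  shows "card leaves + card deg2 + 1 \<le> card V"
proof -
  have disj: "leaves \<inter> deg2 = {}"
    by (auto simp: leaves_def out_degree_G)
  have fin: "finite leaves" "finite deg2" using finite_V by auto
  have sub: "leaves \<union> deg2 \<subseteq> V" by (auto simp: leaves_def)
  have "leaves \<union> deg2 \<noteq> V"
  proof
    assume eq: "leaves \<union> deg2 = V"
    have c: "c \<in> deg2" using eq root_in by (auto simp: leaves_def)
    have "(\<Sum>v\<in>V - {c}. card (children v)) = (\<Sum>v\<in>deg2 - {c}. card (children v))"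
      using eq finite_V by (intro sum.mono_neutral_right) (auto simp: leaves_def)
    also have "\<dots> = (\<Sum>v\<in>deg2 - {c}. 1)"
      by (rule sum.cong) (auto simp: out_degree_G)
    also have "\<dots> = card deg2 - 1" using c by simp
    finally have "(\<Sum>v\<in>V - {c}. card (children v)) = card deg2 - 1" .
    moreover have "card (children c) = 2" using c root_in by (simp add: out_degree_G)
    ultimately show False using card_V_children assms by simp
  qed
  then have "card (leaves \<union> deg2) < card V"
    using sub finite_V by (intro psubset_card_mono) auto
  then show ?thesis using card_Un_disjoint[OF fin disj] by simp
qed

text \<open>A deepest vertex of \<open>desc v\<close> has no children.\<close>

lemma leaf_below:
  assumes "v \<in> V" "v \<noteq> c"
  shows "\<exists>w\<in>leaves. w \<in> desc v"
proof -
  define m where "m = Max (d ` desc v)"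
  have "m \<in> d ` desc v"
    unfolding m_def using self_desc[OF assms(1)] by (intro Max_in) auto
  then obtain w where w: "w \<in> desc v" "d w = m" by auto
  have max: "d x \<le> m" if "x \<in> desc v" for x
    unfolding m_def using that by (intro Max_ge) auto
  have wV: "w \<in> V" using w desc_subset by blast
  have "w \<noteq> c"
    using desc_depth[OF w(1)] assms d_eq_0[of v] d_root by auto
  moreover have "children w = {}"
  proof (rule ccontr)
    assume "children w \<noteq> {}"
    then obtain x where x: "x \<in> V" "x \<noteq> c" "p x = w" by (auto simp: children_def)
    then have "x \<in> desc v" using w desc_if_parent_desc by auto
    then show False using max parent[of x] x w by fastforce
  qed
  ultimately show ?thesis using w wV by (auto simp: leaves_def)
qed

text \<open>The number of steps from \<open>w\<close> up to \<open>v\<close> is determined because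
  \<open>v\<close> is not the root, where the iterates of \<open>p\<close> would stay.\<close>

lemma desc_iter:
  assumes "w \<in> desc v" "v \<in> V" "v \<noteq> c"
  shows "(p ^^ (d w - d v)) w = v"
proof -
  from assms obtain k where k: "w \<in> V" "(p ^^ k) w = v" by (auto simp: desc_def)
  then have "d v = d w - k" "d v \<noteq> 0" using d_iter[of w k] d_eq_0 assms by auto
  then have "k = d w - d v" by simp
  with k show ?thesis by simp
qed

text \<open>Distinct vertices of one level have distinct leaves below them.\<close>

lemma card_level_le:
  assumes "1 \<le> j"
  shows "card (level j) \<le> card leaves"
proof -
  have *: "v \<in> V \<and> v \<noteq> c \<and> d v = j" if "v \<in> level j" for v
    using that assms d_root by (auto simp: level_def)
  then obtain f where f: "\<And>v. v \<in> level j \<Longrightarrow> f v \<in> leaves \<and> f v \<in> desc v"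
    using leaf_below by metis
  have "inj_on f (level j)"
  proof
    fix v w assume vw: "v \<in> level j" "w \<in> level j" "f v = f w"
    have "(p ^^ (d (f x) - j)) (f x) = x" if "x \<in> level j" for x
      using desc_iter[of "f x" x] f[OF that] *[OF that] by simp
    from this[OF vw(1)] this[OF vw(2)] vw(3) show "v = w" by metis
  qed
  then show ?thesis using f by (intro card_inj_on_le[of f]) auto
qed

section \<open>Minimal sums of depths\<close>

text \<open>Truncated subtraction leaves only the vertices of depth at most \<open>q\<close>, which
  are grouped by level.\<close>

lemma sum_truncated_depths:
  "(\<Sum>v\<in>V - {c}. q + 1 - d v) = (\<Sum>j=1..q. card (level j) * (q + 1 - j))"
proof -
  let ?W = "{v \<in> V - {c}. d v \<le> q}"
  have "(\<Sum>v\<in>V - {c}. q + 1 - d v) = (\<Sum>v\<in>?W. q + 1 - d v)"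
    using finite_V by (intro sum.mono_neutral_right) auto
  also have "\<dots> = (\<Sum>j=1..q. \<Sum>v\<in>{v \<in> ?W. d v = j}. q + 1 - d v)"
    using finite_V by (intro sum.group[symmetric]) (auto simp: Suc_le_eq d_eq_0 simp flip: neq0_conv)
  also have "\<dots> = (\<Sum>j=1..q. \<Sum>v\<in>level j. q + 1 - j)"
    using d_root by (intro sum.cong) (auto simp: level_def)
  finally show ?thesis by simp
qed

text \<open>Pointwise, \<open>d v + (q + 1 - d v)\<close> is the maximum of \<open>d v\<close> and
  \<open>q + 1\<close>. Minimising the depth sum is thereby reduced to bounding the level sizes from
  above and the maxima from below by \<open>q + 1\<close>.\<close>

lemma sum_depths:
  "(\<Sum>v\<in>V. d v) + (\<Sum>j=1..q. card (level j) * (q + 1 - j)) = (\<Sum>v\<in>V - {c}. max (d v) (q + 1))"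
proof -
  have "(\<Sum>v\<in>V. d v) = (\<Sum>v\<in>V - {c}. d v)"
    using sum.remove[OF finite_V root_in, of d] d_root by simp
  then have "(\<Sum>v\<in>V. d v) + (\<Sum>j=1..q. card (level j) * (q + 1 - j))
      = (\<Sum>v\<in>V - {c}. d v + (q + 1 - d v))"
    by (simp only: sum_truncated_depths[symmetric] sum.distrib)
  also have "\<dots> = (\<Sum>v\<in>V - {c}. max (d v) (q + 1))"
    by (rule sum.cong) auto
  finally show ?thesis .
qed

lemma sum_depths_eq:
  assumes "\<And>v. v \<in> V \<Longrightarrow> d v \<le> q + 1" "\<And>j. j \<in> {1..q} \<Longrightarrow> card (level j) = r"
  shows "(\<Sum>v\<in>V. d v) + (\<Sum>j=1..q. r * (q + 1 - j)) = (card V - 1) * (q + 1)"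
proof -
  have "(\<Sum>v\<in>V - {c}. max (d v) (q + 1)) = (\<Sum>v\<in>V - {c}. q + 1)"
    using assms(1) by (intro sum.cong) (auto simp: max_def)
  with sum_depths[of q] assms(2) finite_V root_in show ?thesis by simp
qed

text \<open>The second hypothesis says that the depth sum is at most the least possible value. So
  both estimates are equalities, and then all their summands agree.\<close>

lemma sum_depths_minimal:
  assumes "\<And>j. j \<in> {1..q} \<Longrightarrow> card (level j) \<le> r"
    and "(\<Sum>v\<in>V. d v) + (\<Sum>j=1..q. r * (q + 1 - j)) \<le> (card V - 1) * (q + 1)"
  shows "\<And>v. v \<in> V \<Longrightarrow> d v \<le> q + 1" "\<And>j. j \<in> {1..q} \<Longrightarrow> card (level j) = r"
proof -
  have le: "(\<Sum>j=1..q. card (level j) * (q + 1 - j)) \<le> (\<Sum>j=1..q. r * (q + 1 - j))"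
    using assms(1) by (intro sum_mono mult_le_mono1) auto
  have ge: "(card V - 1) * (q + 1) \<le> (\<Sum>v\<in>V - {c}. max (d v) (q + 1))"
    using sum_mono[of "V - {c}" "\<lambda>_. q + 1" "\<lambda>v. max (d v) (q + 1)"] finite_V root_in by simp
  have eq1: "(\<Sum>v\<in>V - {c}. q + 1) = (\<Sum>v\<in>V - {c}. max (d v) (q + 1))"
    using sum_depths[of q] le ge assms(2) finite_V root_in by simp
  have eq2: "(\<Sum>j=1..q. card (level j) * (q + 1 - j)) = (\<Sum>j=1..q. r * (q + 1 - j))"
    using sum_depths[of q] le ge assms(2) by linarith
  show "d v \<le> q + 1" if "v \<in> V" for v
  proof (cases "v = c")
    case False
    have "q + 1 = max (d v) (q + 1)"
      using eq1 by (rule sum_mono_inv) (use that False finite_V in auto)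
    then show ?thesis by linarith
  qed (simp add: d_root)
  show "card (level j) = r" if "j \<in> {1..q}" for j
  proof -
    have "card (level j) * (q + 1 - j) = r * (q + 1 - j)"
      using eq2 by (rule sum_mono_inv) (use that assms(1) in auto)
    \<comment> \<open>The weight \<open>q + 1 - j\<close> is positive since
      \<open>j \<le> q\<close>, so it cancels.\<close>
    then show ?thesis using that by auto
  qed
qed

section \<open>Counting the children of vertices of degree two\<close>

lemma deg2_children:
  assumes "3 \<le> card (children c)"
  shows "deg2 = {v \<in> V - {c}. card (children v) = 1}"
  using assms by (auto simp: out_degree_G split: if_splits)

text \<open>Vertices of degree two contribute one child each; the last sum is what the other
  non-root vertices contribute. Once the number of children of the root is known, this sum
  determines \<open>card deg2\<close> and conversely.\<close>

lemma card_V_deg2: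
  assumes "3 \<le> card (children c)"
  shows "card V = Suc (card (children c) + card deg2 + (\<Sum>v\<in>V - {c} - deg2. card (children v)))"
proof -
  note D = deg2_children[OF assms]
  have "(\<Sum>v\<in>V - {c}. card (children v))
      = (\<Sum>v\<in>V - {c} - deg2. card (children v)) + (\<Sum>v\<in>deg2. card (children v))"
    using finite_V D by (intro sum.subset_diff) auto
  also have "(\<Sum>v\<in>deg2. card (children v)) = (\<Sum>v\<in>deg2. 1)"
    by (rule sum.cong) (auto simp: D)
  finally show ?thesis using card_V_children by simp
qed

end

section \<open>A tree for comparison\<close>

text \<open>On the vertices \<open>0, \<dots>, n - 1\<close> with root \<open>0\<close>, the parent function \<open>k \<mapsto> k - r\<close> with truncated
  subtraction describes the balanced spider with \<open>r\<close> legs.\<close>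

lemma comparison_tree:
  fixes V :: "'a set"
  assumes V: "finite V" and r: "3 \<le> r" "r + 1 \<le> card V"
  obtains c p d where "rooted_tree V c p d" "tree_of V c p \<in> trees_deg2 (card V) (card V - r - 1)"
    "(\<Sum>v\<in>V. d v) + (\<Sum>j=1..(card V - 1) div r. r * ((card V - 1) div r + 1 - j))
       = (card V - 1) * ((card V - 1) div r + 1)"
proof -
  let ?n = "card V" and ?q = "(card V - 1) div r"
  \<comment> \<open>The competing tree must have vertices of type \<open>'a\<close>, so it is built
    on \<open>V\<close> itself through a numbering \<open>x\<close> with inverse
    \<open>y\<close>.\<close>
  from V obtain x where x: "bij_betw x V {..<?n}"
    using ex_bij_betw_finite_nat[OF V] by (auto simp: atLeast0LessThan)
  define y where "y = inv_into V x"
  have xy: "y k \<in> V \<and> x (y k) = k" if "k < ?n" for k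
    using that x unfolding y_def
    by (metis bij_betw_def bij_betw_inv_into_right inv_into_into lessThan_iff)
  have yx: "y (x v) = v" "x v < ?n" if "v \<in> V" for v
    using that x unfolding y_def by (auto simp: bij_betw_def)
  define c where "c = y 0"
  define p where "p v = y (x v - r)" for v
  \<comment> \<open>This is \<open>x v / r\<close> rounded up: level \<open>j \<ge> 1\<close>
    consists of the numbers from \<open>(j - 1) * r + 1\<close> to \<open>j * r\<close>, as far as
    they are below \<open>card V\<close>.\<close>
  define d where "d v = (x v + r - 1) div r" for v
  have n: "0 < ?n" using r by simp
  have c: "c \<in> V" "x c = 0" using xy n by (auto simp: c_def)
  have x0: "v = c" if "v \<in> V" "x v = 0" for v using yx that by (force simp: c_def)
  have pV: "p v \<in> V" "x (p v) = x v - r" if "v \<in> V" for v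
    using yx(2)[OF that] xy[of "x v - r"] by (auto simp: p_def)
  have rt: "rooted_tree V c p d"
  proof
    fix v assume v: "v \<in> V" "v \<noteq> c"
    then have "x v \<noteq> 0" using x0 by auto
    have "(x v + r - 1) div r = Suc ((x v - r + r - 1) div r)"
    \<comment> \<open>In the first case \<open>x v - r\<close> truncates to \<open>0\<close>, so
      that the parent is the root.\<close>
    proof (cases "x v \<le> r")
      case True
      with \<open>x v \<noteq> 0\<close> have "x v + r - 1 = (x v - 1) + 1 * r" "x v - 1 < r" by auto
      then show ?thesis using True r by (simp only: div_mult_self1) simp
    next
      case False
      then have "x v + r - 1 = (x v - 1) + 1 * r" by simp
      then have "(x v + r - 1) div r = Suc ((x v - 1) div r)" using r by (simp only: div_mult_self1)
      then show ?thesis using False by simp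
    qed
    then show "p v \<in> V \<and> d v = Suc (d (p v))" using pV[OF v(1)] by (simp add: d_def)
  qed (use V c r in \<open>auto simp: p_def d_def c_def\<close>)
  then interpret rooted_tree V c p d .
  have "children c = y ` {1..r}"
  proof
    show "children c \<subseteq> y ` {1..r}"
    proof
      fix v assume "v \<in> children c"
      then have v: "v \<in> V" "v \<noteq> c" "x (p v) = 0" using c by (auto simp: children_def)
      then have "x v \<in> {1..r}" using pV x0[of v] by (auto simp: Suc_le_eq)
      then show "v \<in> y ` {1..r}" using yx v by (metis image_eqI)
    qed
    show "y ` {1..r} \<subseteq> children c"
    proof
      fix v assume "v \<in> y ` {1..r}"
      then obtain k where k: "v = y k" "1 \<le> k" "k \<le> r" by auto
      then have v: "v \<in> V" "x v = k" using xy r by auto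
      then have "p v = c" "v \<noteq> c" using k c by (auto simp: p_def c_def)
      with v show "v \<in> children c" by (simp add: children_def)
    qed
  qed
  moreover have "inj_on y {1..r}"
    using xy r by (intro inj_on_inverseI[of _ x]) auto
  ultimately have chc: "card (children c) = r" by (simp add: card_image)
  \<comment> \<open>Truncation only affects children of the root; a child of any other
    \<open>v\<close> has the number \<open>x v + r\<close>.\<close>
  have ch: "card (children v) \<le> 1" if "v \<in> V - {c}" for v
  proof -
    have "w = w'" if w: "w \<in> children v" "w' \<in> children v" for w w'
    proof -
      have "x v \<noteq> 0" using \<open>v \<in> V - {c}\<close> x0 by auto
      moreover have "x w - r = x v" "x w' - r = x v"
        using w pV(2)[of w] pV(2)[of w'] by (auto simp: children_def)
      ultimately have "x w = x w'" by linarith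
      then show ?thesis using w yx by (metis (no_types, lifting) children_def DiffD1 mem_Collect_eq)
    qed
    then show ?thesis by (simp add: card_le_Suc0_iff_eq)
  qed
  have "(\<Sum>v\<in>V - {c} - deg2. card (children v)) = 0"
    using ch deg2_children chc r by (intro sum.neutral) (auto simp: le_Suc_eq)
  then have "card V = Suc (r + card deg2)"
    using card_V_deg2 chc r by simp
  then have "card deg2 = card V - r - 1" by simp
  then have "G \<in> trees_deg2 (card V) (card V - r - 1)"
    using tree_graph_G by (simp add: trees_deg2_def)
  moreover have "(\<Sum>v\<in>V. d v) + (\<Sum>j=1..?q. r * (?q + 1 - j)) = (?n - 1) * (?q + 1)"
  proof (rule sum_depths_eq)
    fix v assume "v \<in> V"
    then have "x v + r - 1 \<le> ?n - 1 + 1 * r" using yx(2)[of v] by simp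
    then have "d v \<le> (?n - 1 + 1 * r) div r" unfolding d_def by (rule div_le_mono)
    also have "\<dots> = ?q + 1" using r by (simp only: div_mult_self1)
    finally show "d v \<le> ?q + 1" .
  next
    fix j assume j: "j \<in> {1..?q}"
    then have "j * r \<le> ?q * r" by simp
    also have "\<dots> \<le> ?n - 1" by simp
    \<comment> \<open>This makes level \<open>j\<close> complete: all its \<open>r\<close> numbers
      up to \<open>j * r\<close> occur.\<close>
    finally have jr: "j * r < ?n" using n by simp
    obtain i where i: "j = Suc i" using j by (cases j) auto
    have "(k + r - 1) div r = j \<longleftrightarrow> k \<in> {i * r + 1..j * r}" for k
    proof -
      have "(k + r - 1) div r = j \<longleftrightarrow> j \<le> (k + r - 1) div r \<and> (k + r - 1) div r < j + 1" by auto
      also have "\<dots> \<longleftrightarrow> j * r \<le> k + r - 1 \<and> k + r - 1 < (j + 1) * r"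
        using r by (simp only: less_eq_div_iff_mult_less_eq div_less_iff_less_mult)
      also have "\<dots> \<longleftrightarrow> k \<in> {i * r + 1..j * r}"
        using r i by auto
      finally show ?thesis .
    qed
    then have "level j = {v \<in> V. x v \<in> {i * r + 1..j * r}}"
      by (simp add: level_def d_def)
    also have "\<dots> = y ` {i * r + 1..j * r}"
    proof
      show "{v \<in> V. x v \<in> {i * r + 1..j * r}} \<subseteq> y ` {i * r + 1..j * r}"
        using yx(1) by (metis (no_types, lifting) imageI mem_Collect_eq subsetI)
      show "y ` {i * r + 1..j * r} \<subseteq> {v \<in> V. x v \<in> {i * r + 1..j * r}}"
        using xy jr by auto
    qed
    finally have "level j = y ` {i * r + 1..j * r}" .
    moreover have "inj_on y {i * r + 1..j * r}"
      using xy jr by (intro inj_on_inverseI[of _ x]) auto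
    ultimately show "card (level j) = r" using i by (simp add: card_image)
  qed
  ultimately show thesis using that rt by blast
qed

section \<open>Spiders\<close>

text \<open>All arcs join non-root vertices and their parents, so an injection compatible with
  parents there carries arcs to arcs.\<close>

lemma digraph_iso_tree_of:
  assumes "rooted_tree V c p d" "inj_on f V" "\<And>v. v \<in> V - {c} \<Longrightarrow> p' (f v) = f (p v)"
  shows "digraph_iso (with_proj (tree_of V c p)) (with_proj (tree_of (f ` V) (f c) p'))"
proof -
  interpret rooted_tree V c p d by fact
  interpret pair_graph G by (rule pair_graph_G)
  let ?h = "\<lparr>iso_verts = f, iso_arcs = map_prod f f, iso_head = snd, iso_tail = fst\<rparr>"
  have "inj_on (map_prod f f) (parcs G)"
    using map_prod_inj_on[OF assms(2) assms(2)]
    by (rule inj_on_subset) (auto dest: in_arcsD1 in_arcsD2)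
  then have "digraph_isomorphism ?h"
    using wf_digraph_axioms assms(2) by (auto simp: digraph_isomorphism_def)
  moreover have "f ` V - {f c} = f ` (V - {c})"
    using inj_on_image_set_diff[OF assms(2), of V "{c}"] root_in by auto
  then have "parcs (tree_of (f ` V) (f c) p') = map_prod f f ` parcs G"
    using assms(3) by (auto simp: tree_of_def image_UN)
  then have "with_proj (tree_of (f ` V) (f c) p') = app_iso ?h (with_proj G)"
    by (simp add: app_iso_def with_proj_def tree_of_def)
  ultimately show ?thesis unfolding digraph_iso_def by blast
qed

lemma spider_tree_of:
  "spider r l = tree_of (insert (0, 0) (SIGMA i:{..<r}. {1..l i})) (0, 0) spider_parent"
  by (auto simp: spider_def tree_of_def Let_def)

text \<open>\<open>balanced_spider\<close> lists its long legs first, so the branches of a tree have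
  to be numbered with the long ones first.\<close>

lemma bij_betw_prescribed_image:
  assumes "finite B" "S \<subseteq> B"
  obtains g where "bij_betw g B {..<card B}" "g ` S = {..<card S}"
proof -
  have fin: "finite S" "finite (B - S)" using assms finite_subset by auto
  obtain g1 where g1: "bij_betw g1 S {..<card S}"
    using ex_bij_betw_finite_nat[OF fin(1)] by (auto simp: atLeast0LessThan)
  have "card {card S..<card B} = card (B - S)"
    using assms fin by (simp add: card_Diff_subset)
  then obtain g2 where g2: "bij_betw g2 (B - S) {card S..<card B}"
    using finite_same_card_bij[OF fin(2), of "{card S..<card B}"] by auto
  define g where "g v = (if v \<in> S then g1 v else g2 v)" for v
  have S: "bij_betw g S {..<card S}"
    using g1 by (subst bij_betw_cong[of _ _ g1]) (auto simp: g_def)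
  have "bij_betw g (B - S) {card S..<card B}"
    using g2 by (subst bij_betw_cong[of _ _ g2]) (auto simp: g_def)
  with S have "bij_betw g (S \<union> (B - S)) ({..<card S} \<union> {card S..<card B})"
    by (rule bij_betw_combine) auto
  moreover have "{..<card S} \<union> {card S..<card B} = {..<card B}"
    using card_mono[OF assms] by auto
  ultimately have "bij_betw g B {..<card B}"
    using assms by (simp add: Un_absorb1)
  with S that show thesis by (auto simp: bij_betw_def)
qed

text \<open>The branches at the root are paths, so a non-root vertex is determined by the number of
  its branch and its depth; these become its coordinates in the spider.\<close>

lemma (in rooted_tree) digraph_iso_balanced_spider:
  assumes r: "1 \<le> r" "r \<le> card V - 1" "q = (card V - 1) div r"
    and depth: "\<And>v. v \<in> V \<Longrightarrow> d v \<le> q + 1"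
    and levels: "\<And>j. j \<in> {1..q} \<Longrightarrow> card (level j) = r"
    and paths: "\<And>v. v \<in> V - {c} \<Longrightarrow> card (children v) \<le> 1"
  shows "digraph_iso (with_proj G) (with_proj (balanced_spider (card V) r))"
proof -
  \<comment> \<open>For a non-root \<open>v\<close> this is the child of the root whose branch
    contains \<open>v\<close>.\<close>
  define top where "top v = (p ^^ (d v - 1)) v" for v
  define s where "s = card V - 1 - r * q"
  have q: "1 \<le> q" using r by (simp add: Suc_le_eq div_greater_zero_iff)
  have d_pos: "1 \<le> d v" if "v \<in> V" "v \<noteq> c" for v
    using parent[of v] that by simp
  have top_p: "top (p v) = top v" if "v \<in> V" "2 \<le> d v" for v
  proof -
    have "d v - 1 = Suc (d (p v) - 1)" using that by (simp add: d_p)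
    then show ?thesis by (simp add: top_def funpow_swap1)
  qed
  have p_not_root: "p v \<in> V - {c}" if "v \<in> V - {c}" "\<not> d v \<le> 1" for v
    using that parent[of v] d_root by auto
  have top_in: "top v \<in> level 1" if "v \<in> V" "v \<noteq> c" for v
    using d_pos[OF that] that by (simp add: level_def top_def d_iter iter_in)
  \<comment> \<open>As non-root vertices have at most one child, two vertices of equal depth in one
    branch coincide once their parents do.\<close>
  have top_inj: "v = w" if "v \<in> V - {c}" "w \<in> V - {c}" "d v = d w" "top v = top w" for v w
    using that
  proof (induction "d v" arbitrary: v w rule: less_induct)
    case less
    show ?case
    proof (cases "d v \<le> 1")
      case True
      then show ?thesis using less.prems by (simp add: top_def)
    next
      case False
      have ps: "p v \<in> V - {c}" "p w \<in> V - {c}"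
        using less.prems(1-3) False p_not_root by simp_all
      have "p v = p w"
      proof (rule less.hyps)
        show "d (p v) < d v" using False less.prems(1) by (simp add: d_p)
        show "d (p v) = d (p w)" using less.prems(1-3) by (simp add: d_p)
        show "top (p v) = top (p w)"
          using top_p[of v] top_p[of w] less.prems False by simp
      qed (fact ps)+
      then have "v \<in> children (p v)" "w \<in> children (p v)"
        using less.prems by (auto simp: children_def)
      then show ?thesis using paths[OF ps(1)] card_le_Suc0_iff_eq[of "children (p v)"] by auto
    qed
  qed
  \<comment> \<open>These are the branches that reach level \<open>q + 1\<close> and become the long
    legs.\<close>
  define S where "S = top ` level (q + 1)"
  have level_V: "v \<in> V - {c}" if "v \<in> level j" "1 \<le> j" for v j
    using that d_root by (auto simp: level_def)
  have V_UN: "V - {c} = (\<Union>j\<in>{1..q + 1}. level j)"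
  proof
    show "V - {c} \<subseteq> (\<Union>j\<in>{1..q + 1}. level j)"
    proof
      fix v assume "v \<in> V - {c}"
      then have "d v \<in> {1..q + 1}" "v \<in> level (d v)" using d_pos depth by (auto simp: level_def)
      then show "v \<in> (\<Union>j\<in>{1..q + 1}. level j)" by blast
    qed
    show "(\<Union>j\<in>{1..q + 1}. level j) \<subseteq> V - {c}" by (auto simp: level_def d_root)
  qed
  \<comment> \<open>Levels \<open>1\<close> to \<open>q\<close> take up \<open>r * q\<close>
    vertices, so level \<open>q + 1\<close> holds the remaining \<open>s\<close>.\<close>
  have "card (\<Union>j\<in>{1..q + 1}. level j) = (\<Sum>j=1..q + 1. card (level j))"
    by (rule card_UN_disjoint) (auto simp: level_def finite_V)
  then have "card (V - {c}) = (\<Sum>j=1..q + 1. card (level j))" by (simp only: V_UN)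
  also have "\<dots> = (\<Sum>j=1..q. card (level j)) + card (level (q + 1))" by simp
  also have "(\<Sum>j=1..q. card (level j)) = r * q" using levels by simp
  finally have "card (V - {c}) = r * q + card (level (q + 1))" .
  moreover have "card (V - {c}) = card V - 1" using root_in finite_V by simp
  ultimately have "card (level (q + 1)) = s" by (simp add: s_def)
  moreover have "inj_on top (level (q + 1))"
    by (rule inj_onI, rule top_inj) (use level_V in \<open>auto simp: level_def\<close>)
  ultimately have card_S: "card S = s" by (simp add: S_def card_image)
  have "S \<subseteq> level 1" using top_in level_V by (force simp: S_def)
  moreover have "card (level 1) = r" using levels q by simp
  ultimately obtain g where g: "bij_betw g (level 1) {..<r}" "g ` S = {..<s}"
    using bij_betw_prescribed_image[of "level 1" S] card_S by auto
  define f where "f v = (if v = c then (0, 0) else (g (top v), d v))" for v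
  have inj: "inj_on f V"
  proof
    fix v w assume vw: "v \<in> V" "w \<in> V" "f v = f w"
    have "snd (f x) = d x" for x by (simp add: f_def d_root)
    with vw(3) have dvw: "d v = d w" by metis
    show "v = w"
    proof (cases "v = c \<or> w = c")
      case True
      then show ?thesis using dvw d_eq_0[OF vw(1)] d_eq_0[OF vw(2)] d_root by metis
    next
      case False
      then have "g (top v) = g (top w)" using vw(3) by (simp add: f_def)
      with g(1) have top_eq: "top v = top w"
        by (rule inj_onD[OF bij_betw_imp_inj_on]) (use top_in vw False in auto)
      show ?thesis by (rule top_inj[OF _ _ dvw top_eq]) (use vw False in simp_all)
    qed
  qed
  let ?l = "\<lambda>i. if i < s then q + 1 else q"
  let ?H = "balanced_spider (card V) r"
  have H: "?H = spider r ?l" by (simp only: balanced_spider_def s_def r(3) Let_def)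
  \<comment> \<open>Only this inclusion is checked by coordinates; equality follows as both sets
    have \<open>card V\<close> elements.\<close>
  have "f ` V \<subseteq> pverts ?H"
  proof
    fix x assume "x \<in> f ` V"
    then obtain v where v: "v \<in> V" "x = f v" by auto
    show "x \<in> pverts ?H"
    proof (cases "v = c")
      case False
      have "g (top v) < r" using g(1) top_in[OF v(1) False] by (auto simp: bij_betw_def)
      moreover have "d v \<le> ?l (g (top v))"
      proof (cases "d v = q + 1")
        case True
        then have "g (top v) \<in> g ` S" using v by (simp add: S_def level_def)
        then show ?thesis using g(2) True by simp
      next
        case False
        then show ?thesis using depth[OF v(1)] by simp
      qed
      ultimately show ?thesis
        using False v d_pos[OF v(1) False] by (auto simp: H spider_def f_def Let_def)
    qed (simp add: v H spider_def f_def Let_def)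
  qed
  moreover have "card (pverts ?H) = card (f ` V)"
    using card_balanced_spider[OF r(1,2)] card_image[OF inj] by simp
  moreover have "finite (pverts ?H)" by (simp add: H spider_def Let_def)
  ultimately have fV: "f ` V = pverts ?H" by (simp add: card_subset_eq)
  have "tree_of (f ` V) (f c) spider_parent = ?H"
    unfolding fV H by (simp add: spider_tree_of f_def tree_of_def)
  moreover have "spider_parent (f v) = f (p v)" if v: "v \<in> V - {c}" for v
  proof (cases "d v = 1")
    case True
    then have "p v = c" using d_p[of v] v d_eq_0[OF p_in] by simp
    then show ?thesis using v True by (simp add: spider_parent_def f_def)
  next
    case False
    then have "p v \<noteq> c" "2 \<le> d v" using d_p[of v] d_pos[of v] v d_root by auto
    then show ?thesis using v False top_p[of v] by (simp add: spider_parent_def f_def d_p)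
  qed
  ultimately show ?thesis
    using digraph_iso_tree_of[OF rooted_tree_axioms inj, of spider_parent] by simp
qed

theorem theorem4p1:
  fixes n t :: nat and T :: "'a pair_pre_digraph"
  assumes "t + 4 \<le> n"
    and "T \<in> trees_deg2 n t"
    and "\<forall>T' \<in> (trees_deg2 n t :: 'a pair_pre_digraph set). Mostar T' \<le> Mostar T"
  shows "digraph_iso (with_proj T) (with_proj (balanced_spider n (n - t - 1)))"
proof -
  define r where "r = n - t - 1"
  define q where "q = (n - 1) div r"
  define K where "K = (\<Sum>j=1..q. r * (q + 1 - j))"
  have r: "3 \<le> r" "r + 1 \<le> n" using assms(1) by (auto simp: r_def)
  have q: "1 \<le> q" using r by (simp add: q_def Suc_le_eq div_greater_zero_iff)
  let ?V = "pverts T"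
  have T: "tree_graph T" "card ?V = n" "card {v \<in> ?V. out_degree (with_proj T) v = 2} = t"
    using assms(2) by (auto simp: trees_deg2_def)
  obtain c p d where rt: "rooted_tree ?V c p d" and eq: "T = tree_of ?V c p"
    and centroid: "\<And>v. v \<in> ?V - {c} \<Longrightarrow> 2 * card (rooted_tree.desc ?V p v) \<le> card ?V"
    using centroid_exists[OF T(1)] by blast
  interpret rooted_tree ?V c p d by (rule rt)
  have t: "card deg2 = t" using T(3) by (simp flip: eq)
  then have "card leaves \<le> r" using card_leaves_le assms(1) T(2) by (simp add: r_def)
  then have level: "card (level j) \<le> r" if "j \<in> {1..q}" for j
    using card_level_le[of j] that by simp
  have "n - r - 1 = t" using assms(1) by (simp add: r_def)
  then obtain c' p' d' where rt': "rooted_tree ?V c' p' d'"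
    and T': "tree_of ?V c' p' \<in> trees_deg2 n t"
    and sum': "(\<Sum>v\<in>?V. d' v) + K = (n - 1) * (q + 1)"
    using comparison_tree[OF finite_V r(1)] r(2) T(2) unfolding K_def q_def by metis
  \<comment> \<open>For the comparison tree the lower bound valid for any root suffices; the exact
    formula is applied to \<open>T\<close>, rooted at a centroid.\<close>
  have "Mostar (tree_of ?V c' p') \<ge> int n * (int n - 1) - 2 * int (\<Sum>v\<in>?V. d' v)"
    using rooted_tree.Mostar_ge[OF rt'] T(2) by simp
  moreover have "Mostar (tree_of ?V c' p') \<le> Mostar T" using assms(3) T' by blast
  moreover have "Mostar T = int n * (int n - 1) - 2 * int (\<Sum>v\<in>?V. d v)"
    using Mostar_eq[OF centroid] T(2) by (simp flip: eq)
  ultimately have "(\<Sum>v\<in>?V. d v) \<le> (\<Sum>v\<in>?V. d' v)" by linarith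
  with sum' have min: "(\<Sum>v\<in>?V. d v) + (\<Sum>j=1..q. r * (q + 1 - j)) \<le> (card ?V - 1) * (q + 1)"
    using T(2) by (simp add: K_def)
  note depth = sum_depths_minimal(1)[OF level min] and levels = sum_depths_minimal(2)[OF level min]
  have chc: "card (children c) = r" using levels[of 1] q level_1 by simp
  \<comment> \<open>As \<open>n = 1 + r + t\<close>, \<open>card_V_deg2\<close> leaves no child for
    non-root vertices outside \<open>deg2\<close>.\<close>
  have "(\<Sum>v\<in>?V - {c} - deg2. card (children v)) = 0"
    using card_V_deg2 chc r t T(2) assms(1) by (simp add: r_def)
  then have "card (children v) = 0" if "v \<in> ?V - {c} - deg2" for v
    using that finite_V by (subst (asm) sum_eq_0_iff) auto
  then have paths: "card (children v) \<le> 1" if "v \<in> ?V - {c}" for v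
    using that deg2_children chc r(1) by (cases "v \<in> deg2") force+
  have "digraph_iso (with_proj G) (with_proj (balanced_spider (card ?V) r))"
    using r T(2) depth levels paths by (intro digraph_iso_balanced_spider[of r q]) (auto simp: q_def)
  then show ?thesis using T(2) r_def by (simp flip: eq)
qed

end
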